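(* The probability of obtaining a connected surface in both of the following models is asymptotically $1$. More precisely: (1) Let $(\sigma,\tau)$ be a uniformly random pair of permutations from $S_n\times S_n$. Then $$\Pr(S(\sigma,\tau)\text{ is connected})=1-\frac1n+O\left(\frac1{n^2}\right)\quad\text{as }n\to\infty.$$ (2) Fix $\alpha\in[0,1)$. Let $(\sigma,\tau)$ be a uniformly random pair of permutations from $\mathcal{K}_{\mu_n}\times S_n$, where $\mu_n\vdash n$ is a partition of $n$ with at most $n^\alpha$ parts. Then $$\Pr(S(\sigma,\tau)\text{ is connected})>1-\frac1{n^{1-\alpha}}-O\left(\frac1{n^{2-\alpha}}\right)\quad\text{as }n\to\infty.$$
   Context: $S_n$ is the symmetric group on $\{1,\dots,n\}$; $\mathcal{K}_{\mu_n}$ is the conjugacy class of $S_n$ of permutations with cycle type $\mu_n$. For $\sigma,\tau\in S_n$, $S(\sigma,\tau)$ is the square-tiled surface built from $n$ axis-parallel unit squares labelled $1,\dots,n$, where the right side of square $j$ is glued by translation to the left side of square $\sigma(j)$ and the top side of square $j$ to the bottom side of square $\tau(j)$. It is connected if and only if the subgroup $\langle\sigma,\tau\rangle\le S_n$ acts transitively on $\{1,\dots,n\}$. *)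

theory Defs
  imports
    "HOL-Probability.Probability"
    "HOL-Combinatorics.Combinatorics"
    "HOL-Library.Landau_Symbols"
begin

section \<open>Square-tiled surfaces\<close>

text \<open>The point \<open>(j, x, y)\<close> is the point with coordinates \<open>(x, y)\<close> of the \<open>j\<close>-th closed unit square.\<close>

definition squares :: "nat \<Rightarrow> (nat \<times> real \<times> real) topology" where
  "squares n = sum_topology (\<lambda>j. top_of_set ({0..1} \<times> {0..1})) {1..n}"

inductive glued ::
    "nat \<Rightarrow> (nat \<Rightarrow> nat) \<Rightarrow> (nat \<Rightarrow> nat) \<Rightarrow> nat \<times> real \<times> real \<Rightarrow> nat \<times> real \<times> real \<Rightarrow> bool"
  for n \<sigma> \<tau> where
  right_left: "j \<in> {1..n} \<Longrightarrow> y \<in> {0..1} \<Longrightarrow> glued n \<sigma> \<tau> (j, 1, y) (\<sigma> j, 0, y)"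
| top_bottom: "j \<in> {1..n} \<Longrightarrow> x \<in> {0..1} \<Longrightarrow> glued n \<sigma> \<tau> (j, x, 1) (\<tau> j, x, 0)"

definition glue_rel ::
    "nat \<Rightarrow> (nat \<Rightarrow> nat) \<Rightarrow> (nat \<Rightarrow> nat) \<Rightarrow> ((nat \<times> real \<times> real) \<times> (nat \<times> real \<times> real)) set" where
  "glue_rel n \<sigma> \<tau> =
     {(p, q). p \<in> topspace (squares n) \<and> q \<in> topspace (squares n) \<and> equivclp (glued n \<sigma> \<tau>) p q}"

definition quotient_space :: "'a topology \<Rightarrow> ('a \<times> 'a) set \<Rightarrow> 'a set topology" where
  "quotient_space X r = topology (\<lambda>U. U \<subseteq> topspace X // r \<and> openin X (\<Union>U))"

definition square_tiled_surface ::
    "nat \<Rightarrow> (nat \<Rightarrow> nat) \<Rightarrow> (nat \<Rightarrow> nat) \<Rightarrow> (nat \<times> real \<times> real) set topology" where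
  "square_tiled_surface n \<sigma> \<tau> = quotient_space (squares n) (glue_rel n \<sigma> \<tau>)"

lemma openin_quotient_space:
  assumes "equiv (topspace X) r"
  shows "openin (quotient_space X r) U \<longleftrightarrow> U \<subseteq> topspace X // r \<and> openin X (\<Union>U)"
proof -
  have "istopology (\<lambda>U. U \<subseteq> topspace X // r \<and> openin X (\<Union>U))"
    unfolding istopology_def
  proof (intro conjI allI impI)
    fix S T
    assume S: "S \<subseteq> topspace X // r \<and> openin X (\<Union>S)" and T: "T \<subseteq> topspace X // r \<and> openin X (\<Union>T)"
    have "\<Union>(S \<inter> T) = \<Union>S \<inter> \<Union>T"
    proof
      show "\<Union>S \<inter> \<Union>T \<subseteq> \<Union>(S \<inter> T)"
      proof
        fix x assume "x \<in> \<Union>S \<inter> \<Union>T"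
        then obtain A B where AB: "A \<in> S" "x \<in> A" "B \<in> T" "x \<in> B" by auto
        then have "A = B" using quotient_disj[OF assms, of A B] S T by blast
        then show "x \<in> \<Union>(S \<inter> T)" using AB by auto
      qed
    qed auto
    then show "openin X (\<Union>(S \<inter> T))" using S T by auto
  next
    fix K
    assume K: "\<forall>U\<in>K. U \<subseteq> topspace X // r \<and> openin X (\<Union>U)"
    have "\<Union>(\<Union>K) = \<Union>((\<lambda>U. \<Union>U) ` K)" by auto
    moreover have "openin X (\<Union>((\<lambda>U. \<Union>U) ` K))" by (rule openin_Union) (use K in blast)
    ultimately show "openin X (\<Union>(\<Union>K))" by simp
  qed auto
  then show ?thesis by (simp add: quotient_space_def)
qed

lemma quotient_map_quotient_space:
  assumes r: "equiv (topspace X) r"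
  shows "quotient_map X (quotient_space X r) (\<lambda>x. r `` {x})"
proof -
  have top: "topspace (quotient_space X r) = topspace X // r"
  proof
    show "topspace (quotient_space X r) \<subseteq> topspace X // r"
      unfolding topspace_def[of "quotient_space X r"] openin_quotient_space[OF r] by blast
    have "openin (quotient_space X r) (topspace X // r)"
      by (simp add: openin_quotient_space[OF r] Union_quotient[OF r])
    then show "topspace X // r \<subseteq> topspace (quotient_space X r)"
      by (rule openin_subset)
  qed
  have eq: "{x \<in> topspace X. r `` {x} \<in> U} = \<Union>U" if sub: "U \<subseteq> topspace X // r" for U
  proof (intro equalityI subsetI)
    fix x assume "x \<in> {x \<in> topspace X. r `` {x} \<in> U}"
    then show "x \<in> \<Union>U" using equiv_class_self[OF r, of x] by blast
  next
    fix x assume "x \<in> \<Union>U"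
    then obtain A where A: "A \<in> U" "x \<in> A" by auto
    then obtain a where a: "A = r `` {a}" using sub unfolding quotient_def by blast
    then have "(a, x) \<in> r" using A by auto
    then have "r `` {x} = A" "x \<in> topspace X"
      using a equiv_class_eq[OF r] equiv_type[OF r] by auto
    then show "x \<in> {x \<in> topspace X. r `` {x} \<in> U}" using A by auto
  qed
  show ?thesis
    unfolding quotient_map_def top
  proof (intro conjI allI impI)
    show "(\<lambda>x. r `` {x}) ` topspace X = topspace X // r" by (auto simp: quotient_def)
  next
    fix U assume U: "U \<subseteq> topspace X // r"
    then show "openin X {x \<in> topspace X. r `` {x} \<in> U} = openin (quotient_space X r) U"
      by (simp add: eq openin_quotient_space[OF r])
  qed
qed

lemma equiv_glue_rel: "equiv (topspace (squares n)) (glue_rel n \<sigma> \<tau>)"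
proof (rule equivI)
  show "glue_rel n \<sigma> \<tau> \<subseteq> topspace (squares n) \<times> topspace (squares n)"
    by (auto simp: glue_rel_def)
  show "refl_on (topspace (squares n)) (glue_rel n \<sigma> \<tau>)"
    by (auto simp: glue_rel_def refl_on_def)
  show "sym (glue_rel n \<sigma> \<tau>)"
    by (auto simp: glue_rel_def sym_def intro: equivclp_sym)
  show "trans (glue_rel n \<sigma> \<tau>)"
    by (auto simp: glue_rel_def trans_def intro: equivclp_trans)
qed

section \<open>Permutations and cycle types\<close>

definition sym_perms :: "nat \<Rightarrow> (nat \<Rightarrow> nat) set" where
  "sym_perms n = {\<sigma>. \<sigma> permutes {1..n}}"

text \<open>Partitions are multisets of positive parts.\<close>

definition is_partition :: "nat \<Rightarrow> nat multiset \<Rightarrow> bool" where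
  "is_partition n \<mu> \<longleftrightarrow> 0 \<notin># \<mu> \<and> \<Sum>\<^sub># \<mu> = n"

text \<open>Fixed points contribute parts equal to 1.\<close>

definition cycle_type :: "nat \<Rightarrow> (nat \<Rightarrow> nat) \<Rightarrow> nat multiset" where
  "cycle_type n \<sigma> = image_mset card (mset_set (orbit \<sigma> ` {1..n}))"

definition conj_class :: "nat \<Rightarrow> nat multiset \<Rightarrow> (nat \<Rightarrow> nat) set" where
  "conj_class n \<mu> = {\<sigma> \<in> sym_perms n. cycle_type n \<sigma> = \<mu>}"

section \<open>Random surfaces\<close>

definition prob_connected :: "nat \<Rightarrow> ((nat \<Rightarrow> nat) \<times> (nat \<Rightarrow> nat)) set \<Rightarrow> real" where
  "prob_connected n A =
     measure_pmf.prob (pmf_of_set A) {(\<sigma>, \<tau>). connected_space (square_tiled_surface n \<sigma> \<tau>)}"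

end

theory Submission
  imports Defs "HOL-Real_Asymp.Real_Asymp"
begin

text \<open>
  The surface is connected exactly when \<open>\<sigma>\<close> and \<open>\<tau>\<close> preserve no proper nonempty set of squares: the
  squares of a preserved set are glued only among themselves, and conversely a clopen part of the
  surface contains each square, being connected, entirely or not at all. What remains is to count
  pairs of permutations preserving a common set \<open>A\<close>, which by passing to the complement may be assumed
  to have size \<open>s \<le> n / 2\<close>. A uniformly random permutation preserves a given \<open>A\<close> with probability
  \<open>1 / (n choose s)\<close>.

  For a random pair, the union bound over all \<open>A\<close> gives the sum of \<open>1 / (n choose s)\<close> over
  \<open>1 \<le> s \<le> n / 2\<close>, which is \<open>1 / n + O(1 / n\<^sup>2)\<close>.

  For a fixed \<open>\<sigma>\<close> with \<open>k\<close> cycles the union bound over all \<open>\<sigma>\<close>-invariant sets is too weak: if most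
  cycles are fixed points, the sets of two fixed points alone contribute about \<open>k\<^sup>2 / n\<^sup>2\<close>, which is not
  \<open>O(k / n\<^sup>2)\<close>. Sets of fixed points are therefore treated all at once. The probability that \<open>\<tau>\<close> has
  a cycle inside a given set \<open>F\<close> is exactly \<open>card F / n\<close> (lemma \<open>card_some_cycle_inside\<close>), and so the
  fixed points of \<open>\<sigma>\<close> contribute at most \<open>k / n\<close>. Any other invariant set of size \<open>s\<close> contains a
  nontrivial cycle of \<open>\<sigma>\<close> and hence is a union of at most \<open>s - 1\<close> cycles; there are at most
  \<open>(k + s - 1) choose (s - 1)\<close> of these (lemma \<open>card_invariant_sets_le\<close>), and the union bound over them
  costs only \<open>O(k / n\<^sup>2)\<close>, uniformly for \<open>k \<le> n / 4\<close> (lemma \<open>block_union_bound_le\<close>). With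
  \<open>k \<le> n powr \<alpha>\<close> this is the claim for conjugacy classes.

  The same exact count gives the matching lower bound on disconnected pairs: averaged over \<open>\<sigma>\<close>, the
  number of fixed points is 1, so \<open>\<tau>\<close> has a cycle inside the fixed points of \<open>\<sigma>\<close> with probability
  \<open>1 / n\<close>, and the pair is then disconnected unless \<open>\<sigma> = id\<close>.
\<close>

section \<open>Connectedness and transitivity\<close>

lemma permutes_image_eq:
  assumes "\<sigma> permutes S" "finite S" "A \<subseteq> S" "\<sigma> ` A \<subseteq> A"
  shows "\<sigma> ` A = A"
  using assms finite_subset by (metis endo_inj_surj inj_on_subset permutes_inj subset_UNIV)

lemma permutes_invariant_iff:
  assumes "\<sigma> permutes S" "finite S" "A \<subseteq> S" "\<sigma> ` A \<subseteq> A"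
  shows "\<sigma> x \<in> A \<longleftrightarrow> x \<in> A"
  using permutes_image_eq[OF assms] permutes_inj[OF assms(1)] by (metis inj_image_mem_iff)

definition intransitive :: "'a set \<Rightarrow> ('a \<Rightarrow> 'a) \<Rightarrow> ('a \<Rightarrow> 'a) \<Rightarrow> bool" where
  "intransitive S \<sigma> \<tau> \<longleftrightarrow> (\<exists>A. A \<noteq> {} \<and> A \<subset> S \<and> \<sigma> ` A \<subseteq> A \<and> \<tau> ` A \<subseteq> A)"

lemma topspace_squares: "topspace (squares n) = {1..n} \<times> {0..1} \<times> {0..1}"
  by (auto simp: squares_def)

lemma glue_rel_fst_iff:
  assumes \<sigma>: "\<sigma> permutes {1..n}" and \<tau>: "\<tau> permutes {1..n}"
    and A: "A \<subseteq> {1..n}" "\<sigma> ` A \<subseteq> A" "\<tau> ` A \<subseteq> A"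
    and pq: "(p, q) \<in> glue_rel n \<sigma> \<tau>"
  shows "fst p \<in> A \<longleftrightarrow> fst q \<in> A"
proof -
  have step: "fst p \<in> A \<longleftrightarrow> fst q \<in> A" if "glued n \<sigma> \<tau> p q" for p q
    using that permutes_invariant_iff[OF \<sigma> _ A(1,2)] permutes_invariant_iff[OF \<tau> _ A(1,3)]
    by cases auto
  have "equivclp (glued n \<sigma> \<tau>) p q" using pq by (simp add: glue_rel_def)
  then show ?thesis
    by (induction rule: equivclp_induct) (use step in blast)+
qed

text \<open>The squares labelled by a common invariant set form a clopen part of the disjoint union of the
  squares. It is saturated for the gluing, so it descends to a clopen part of the surface.\<close>

lemma intransitive_imp_disconnected:
  assumes \<sigma>: "\<sigma> permutes {1..n}" and \<tau>: "\<tau> permutes {1..n}"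
    and intr: "intransitive {1..n} \<sigma> \<tau>"
  shows "\<not> connected_space (square_tiled_surface n \<sigma> \<tau>)"
proof -
  let ?r = "glue_rel n \<sigma> \<tau>" and ?X = "squares n"
  note r = equiv_glue_rel[of n \<sigma> \<tau>]
  obtain A where A: "A \<noteq> {}" "A \<subset> {1..n}" "\<sigma> ` A \<subseteq> A" "\<tau> ` A \<subseteq> A"
    using intr by (auto simp: intransitive_def)
  have sat: "fst p \<in> A \<longleftrightarrow> fst q \<in> A" if "(p, q) \<in> ?r" for p q
    using glue_rel_fst_iff[OF \<sigma> \<tau> _ A(3,4) that] A(2) by blast
  define U where "U B = B \<times> ({0..1} \<times> {0..1} :: (real \<times> real) set)" for B :: "nat set"
  define E where "E B = (\<lambda>p. ?r `` {p}) ` U B" for B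
  have sub: "U B \<subseteq> topspace ?X" if "B \<subseteq> {1..n}" for B
    using that by (auto simp: U_def topspace_squares)
  have open_U: "openin ?X (U B)" if "B \<subseteq> {1..n}" for B
    unfolding squares_def U_def openin_sum_topology_alt using that
    by (intro exI[of _ "\<lambda>j. if j \<in> B then {0..1} \<times> {0..1} else {}"]) (auto split: if_splits)
  have open_E: "openin (square_tiled_surface n \<sigma> \<tau>) (E B)"
    if B: "B \<subseteq> {1..n}" "\<And>p q. (p, q) \<in> ?r \<Longrightarrow> fst p \<in> B \<longleftrightarrow> fst q \<in> B" for B
  proof -
    have "\<Union>(E B) = U B"
    proof (intro equalityI subsetI)
      fix q assume "q \<in> \<Union>(E B)"
      then obtain p where p: "p \<in> U B" "(p, q) \<in> ?r" by (auto simp: E_def)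
      then have "fst q \<in> B" using B(2)[OF p(2)] by (auto simp: U_def)
      moreover have "q \<in> topspace ?X" using p equiv_type[OF r] by auto
      ultimately show "q \<in> U B" by (auto simp: U_def topspace_squares)
    next
      fix q assume "q \<in> U B"
      then show "q \<in> \<Union>(E B)" using equiv_class_self[OF r, of q] sub[OF B(1)] by (auto simp: E_def)
    qed
    moreover have "E B \<subseteq> topspace ?X // ?r"
      using sub[OF B(1)] by (auto simp: E_def quotient_def)
    ultimately show ?thesis
      using open_U[OF B(1)] unfolding square_tiled_surface_def openin_quotient_space[OF r] by simp
  qed
  have top: "topspace (square_tiled_surface n \<sigma> \<tau>) = (\<lambda>p. ?r `` {p}) ` topspace ?X"
    using quotient_imp_surjective_map[OF quotient_map_quotient_space[OF r]]
    by (simp add: square_tiled_surface_def)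
  have "openin (square_tiled_surface n \<sigma> \<tau>) (E A)"
    by (rule open_E) (use A sat in auto)
  moreover have "openin (square_tiled_surface n \<sigma> \<tau>) (E ({1..n} - A))"
  proof (rule open_E)
    fix p q assume pq: "(p, q) \<in> ?r"
    then have "fst p \<in> {1..n}" "fst q \<in> {1..n}"
      using equiv_type[OF r] by (auto simp: topspace_squares)
    then show "fst p \<in> {1..n} - A \<longleftrightarrow> fst q \<in> {1..n} - A" using sat[OF pq] by auto
  qed auto
  moreover have "E A \<union> E ({1..n} - A) = topspace (square_tiled_surface n \<sigma> \<tau>)"
  proof -
    have "U A \<union> U ({1..n} - A) = topspace ?X" using A by (auto simp: U_def topspace_squares)
    then show ?thesis unfolding top E_def image_Un[symmetric] by simp
  qed
  moreover have "E A \<inter> E ({1..n} - A) = {}"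
  proof (rule ccontr)
    assume "E A \<inter> E ({1..n} - A) \<noteq> {}"
    then obtain p q where pq: "p \<in> U A" "q \<in> U ({1..n} - A)" "?r `` {p} = ?r `` {q}"
      by (auto simp: E_def)
    then have "(p, q) \<in> ?r"
      using eq_equiv_class_iff[OF r, of p q] sub[of A] sub[of "{1..n} - A"] A(2) by blast
    then show False using sat pq by (auto simp: U_def)
  qed
  moreover have "E A \<noteq> {}" "E ({1..n} - A) \<noteq> {}"
    using A by (auto simp: E_def U_def)
  ultimately show ?thesis unfolding connected_space_eq by blast
qed

text \<open>The preimage of a clopen part of the surface meets each square in a clopen subset, hence in all of
  it or nothing. The labels of the squares it contains are preserved by \<open>\<sigma>\<close> and \<open>\<tau>\<close>, because a right
  or top side lies in the preimage together with the side it is glued to.\<close>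

lemma disconnected_imp_intransitive:
  assumes \<sigma>: "\<sigma> permutes {1..n}" and \<tau>: "\<tau> permutes {1..n}"
    and disc: "\<not> connected_space (square_tiled_surface n \<sigma> \<tau>)"
  shows "intransitive {1..n} \<sigma> \<tau>"
proof -
  let ?r = "glue_rel n \<sigma> \<tau>" and ?X = "squares n" and ?Y = "square_tiled_surface n \<sigma> \<tau>"
  let ?Q = "{0..1} \<times> {0..1} :: (real \<times> real) set"
  note r = equiv_glue_rel[of n \<sigma> \<tau>]
  have q: "quotient_map ?X ?Y (\<lambda>p. ?r `` {p})"
    using quotient_map_quotient_space[OF r] by (simp add: square_tiled_surface_def)
  obtain T where T: "openin ?Y T" "closedin ?Y T" "T \<noteq> {}" "T \<noteq> topspace ?Y"
    using disc by (auto simp: connected_space_clopen_in)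
  define W where "W = {p \<in> topspace ?X. ?r `` {p} \<in> T}"
  have "openin ?X W" "closedin ?X W"
    using T quotient_imp_continuous_map[OF q] unfolding W_def
    by (auto intro: openin_continuous_map_preimage closedin_continuous_map_preimage)
  then have slice: "{x. (j, x) \<in> W} = {} \<or> {x. (j, x) \<in> W} = ?Q" if "j \<in> {1..n}" for j
  proof -
    have "connected ?Q" by (intro connected_Times) auto
    then have "connected_space (top_of_set ?Q)"
      by (simp add: connectedin_def flip: connectedin_iff_connected)
    moreover have "openin (top_of_set ?Q) {x. (j, x) \<in> W}" "closedin (top_of_set ?Q) {x. (j, x) \<in> W}"
      using \<open>openin ?X W\<close> \<open>closedin ?X W\<close> that
      by (auto simp: squares_def openin_sum_topology closedin_sum_topology)
    ultimately show ?thesis unfolding connected_space_clopen_in by auto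
  qed
  define A where "A = {j \<in> {1..n}. (j, 0, 0) \<in> W}"
  have W: "(j, x) \<in> W \<longleftrightarrow> j \<in> A \<and> x \<in> ?Q" for j x
  proof (cases "j \<in> {1..n}")
    case True
    have "(0, 0) \<in> ?Q" by auto
    then show ?thesis using slice[OF True] True unfolding A_def by blast
  next
    case False
    then show ?thesis by (auto simp: A_def W_def topspace_squares)
  qed
  have step: "q \<in> W" if "p \<in> W" "glued n \<sigma> \<tau> p q" "q \<in> topspace ?X" for p q
  proof -
    have "(p, q) \<in> ?r" using that by (auto simp: glue_rel_def W_def)
    then have "?r `` {p} = ?r `` {q}" by (rule equiv_class_eq[OF r])
    then show ?thesis using that by (auto simp: W_def)
  qed
  have "\<sigma> j \<in> A" if "j \<in> A" for j
  proof -
    have j: "j \<in> {1..n}" using that by (simp add: A_def)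
    have "(\<sigma> j, 0, 0) \<in> W"
      using that j permutes_in_image[OF \<sigma>, of j]
      by (intro step[OF _ right_left[OF j, of 0]]) (auto simp: W topspace_squares)
    then show ?thesis by (simp add: W)
  qed
  moreover have "\<tau> j \<in> A" if "j \<in> A" for j
  proof -
    have j: "j \<in> {1..n}" using that by (simp add: A_def)
    have "(\<tau> j, 0, 0) \<in> W"
      using that j permutes_in_image[OF \<tau>, of j]
      by (intro step[OF _ top_bottom[OF j, of 0]]) (auto simp: W topspace_squares)
    then show ?thesis by (simp add: W)
  qed
  moreover have top: "topspace ?Y = (\<lambda>p. ?r `` {p}) ` topspace ?X"
    using quotient_imp_surjective_map[OF q] by simp
  have "W \<noteq> {}"
  proof -
    obtain c where "c \<in> T" using T(3) by blast
    then obtain p where "p \<in> topspace ?X" "c = ?r `` {p}"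
      using openin_subset[OF T(1)] top by auto
    then show ?thesis using \<open>c \<in> T\<close> unfolding W_def by blast
  qed
  moreover have "W \<noteq> topspace ?X"
  proof
    assume "W = topspace ?X"
    then have "topspace ?Y \<subseteq> T" unfolding top by (auto simp: W_def)
    then show False using openin_subset[OF T(1)] T(4) by blast
  qed
  ultimately have "A \<noteq> {}" "A \<noteq> {1..n}" "\<sigma> ` A \<subseteq> A" "\<tau> ` A \<subseteq> A"
    using W by (auto simp: topspace_squares)
  moreover have "A \<subseteq> {1..n}" by (auto simp: A_def)
  ultimately show ?thesis unfolding intransitive_def by blast
qed

lemma connected_iff_not_intransitive:
  assumes "\<sigma> permutes {1..n}" "\<tau> permutes {1..n}"
  shows "connected_space (square_tiled_surface n \<sigma> \<tau>) \<longleftrightarrow> \<not> intransitive {1..n} \<sigma> \<tau>"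
  using intransitive_imp_disconnected[OF assms] disconnected_imp_intransitive[OF assms] by blast

section \<open>Permutations of a given cycle type\<close>

text \<open>The parts are realised one after the other: a new part \<open>p\<close> is an additional cycle on the \<open>p\<close> labels
  following those already used. The uniform distribution on a conjugacy class makes sense only
  because of this lemma.\<close>

lemma exists_perm_of_cycle_type:
  assumes "0 \<notin># \<mu>"
  shows "\<exists>\<sigma>. \<sigma> permutes {1..\<Sum>\<^sub># \<mu>} \<and> cycle_type (\<Sum>\<^sub># \<mu>) \<sigma> = \<mu>"
  using assms
proof (induction \<mu>)
  case empty
  show ?case by (intro exI[of _ id]) (auto simp: cycle_type_def permutes_id)
next
  case (add p \<mu>)
  define m where "m = \<Sum>\<^sub># \<mu>"
  obtain \<sigma> where \<sigma>: "\<sigma> permutes {1..m}" "cycle_type m \<sigma> = \<mu>"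
    using add by (auto simp: m_def)
  have p: "p \<ge> 1" using add.prems by (cases p) auto
  define \<rho> where
    "\<rho> x = (if x \<le> m then \<sigma> x else if x < m + p then Suc x else if x = m + p then m + 1 else x)" for x
  have \<sigma>_le: "\<sigma> x \<le> m \<longleftrightarrow> x \<le> m" for x
    using permutes_in_image[OF \<sigma>(1), of x] permutes_not_in[OF \<sigma>(1), of x]
    by (cases "x = 0") auto
  have \<rho>: "\<rho> permutes {1..m+p}"
  proof (rule bij_imp_permutes)
    have "inj_on \<rho> {1..m+p}"
    proof (rule inj_onI)
      fix x y assume "x \<in> {1..m+p}" "y \<in> {1..m+p}" "\<rho> x = \<rho> y"
      then show "x = y"
        using \<sigma>_le[of x] \<sigma>_le[of y] injD[OF permutes_inj[OF \<sigma>(1)], of x y]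
        by (auto simp: \<rho>_def split: if_splits)
    qed
    moreover have "\<rho> ` {1..m+p} \<subseteq> {1..m+p}"
    proof
      fix y assume "y \<in> \<rho> ` {1..m+p}"
      then obtain x where "x \<in> {1..m+p}" "y = \<rho> x" by auto
      then show "y \<in> {1..m+p}"
        using p permutes_in_image[OF \<sigma>(1), of x] by (auto simp: \<rho>_def)
    qed
    ultimately show "bij_betw \<rho> {1..m+p} {1..m+p}"
      by (simp add: bij_betw_def endo_inj_surj)
    show "\<rho> x = x" if "x \<notin> {1..m+p}" for x
      using that permutes_not_in[OF \<sigma>(1), of x] by (auto simp: \<rho>_def)
  qed
  have old: "orbit \<rho> x = orbit \<sigma> x" if "x \<in> {1..m}" for x
    using permutes_in_image[OF \<rho>] permutes_in_image[OF \<sigma>(1)]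
    by (intro sym[OF orbit_cong0[OF that]]) (auto simp: \<rho>_def)
  have "m + Suc i \<in> orbit \<rho> (m + p)" if "i < p" for i
    using that
  proof (induction i)
    case 0
    have "\<rho> (m + p) = m + 1" using p by (auto simp: \<rho>_def)
    then show ?case using orbit.base[of \<rho> "m + p"] by simp
  next
    case (Suc i)
    then have "\<rho> (m + Suc i) = m + Suc (Suc i)" by (auto simp: \<rho>_def)
    then show ?case using Suc orbit.step[of "m + Suc i" \<rho> "m + p"] by simp
  qed
  then have sub: "{m+1..m+p} \<subseteq> orbit \<rho> (m + p)"
  proof (intro subsetI)
    fix x assume "x \<in> {m+1..m+p}" and *: "\<And>i. i < p \<Longrightarrow> m + Suc i \<in> orbit \<rho> (m + p)"
    then show "x \<in> orbit \<rho> (m + p)" using *[of "x - m - 1"] by auto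
  qed
  moreover have "y \<in> {m+1..m+p}" if "y \<in> orbit \<rho> (m + p)" for y
    using that by induction (use p in \<open>auto simp: \<rho>_def\<close>)
  ultimately have "orbit \<rho> (m + p) = {m+1..m+p}" by blast
  then have cyc: "cyclic_on \<rho> {m+1..m+p}"
    using p unfolding cyclic_on_def by (metis atLeastAtMost_iff le_refl nat_add_left_cancel_le)
  have new: "orbit \<rho> x = {m+1..m+p}" if "x \<in> {m+1..m+p}" for x
    using cyc that by (rule orbit_cyclic_eq3)
  have "{1..m+p} = {1..m} \<union> {m+1..m+p}" by auto
  then have "orbit \<rho> ` {1..m+p} = orbit \<rho> ` {1..m} \<union> orbit \<rho> ` {m+1..m+p}"
    by (metis image_Un)
  also have "orbit \<rho> ` {1..m} = orbit \<sigma> ` {1..m}" using old by (rule image_cong[OF refl])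
  also have "orbit \<rho> ` {m+1..m+p} = (\<lambda>_. {m+1..m+p}) ` {m+1..m+p}"
    using new by (rule image_cong[OF refl])
  finally have orbs: "orbit \<rho> ` {1..m+p} = insert {m+1..m+p} (orbit \<sigma> ` {1..m})"
    using p by (simp add: image_constant_conv)
  have "{m+1..m+p} \<notin> orbit \<sigma> ` {1..m}"
  proof
    assume "{m+1..m+p} \<in> orbit \<sigma> ` {1..m}"
    then obtain x where "x \<in> {1..m}" "{m+1..m+p} = orbit \<sigma> x" by blast
    then have "{m+1..m+p} \<subseteq> {1..m}" using permutes_orbit_subset[OF \<sigma>(1)] by metis
    moreover have "m + p \<in> {m+1..m+p}" using p by simp
    ultimately have "m + p \<in> {1..m}" by (rule subsetD)
    then show False using p by simp
  qed
  then have "cycle_type (m + p) \<rho> = add_mset p (cycle_type m \<sigma>)"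
    unfolding cycle_type_def orbs by (simp add: mset_set.insert)
  then show ?case using \<rho> \<sigma>(2) by (auto simp: m_def add.commute)
qed

lemma conj_class_nonempty:
  assumes "is_partition n \<mu>"
  shows "conj_class n \<mu> \<noteq> {}"
  using exists_perm_of_cycle_type[of \<mu>] assms
  by (auto simp: is_partition_def conj_class_def sym_perms_def)

section \<open>Permutations with a cycle inside a given set\<close>

definition no_cycle_inside :: "'a set \<Rightarrow> 'a set \<Rightarrow> ('a \<Rightarrow> 'a) set" where
  "no_cycle_inside S F = {\<tau>. \<tau> permutes S \<and> (\<forall>B. B \<subseteq> F \<longrightarrow> \<tau> ` B \<subseteq> B \<longrightarrow> B = {})}"

text \<open>Each permutation of \<open>insert a S\<close> arises uniquely from a permutation \<open>\<tau>\<close> of \<open>S\<close> by inserting \<open>a\<close>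
  immediately before some \<open>b \<in> S\<close> in its cycle, or by making \<open>a\<close> a fixed point (\<open>b = a\<close>). The last
  choice creates a cycle inside \<open>insert a F\<close>; the others turn cycles inside \<open>F\<close> into cycles inside
  \<open>insert a F\<close> and back.\<close>

lemma no_cycle_inside_insert:
  assumes S: "finite S" "a \<notin> S" "F \<subseteq> S"
  shows "no_cycle_inside (insert a S) (insert a F) =
    (\<lambda>(b, \<tau>). Transposition.transpose a b \<circ> \<tau>) ` (S \<times> no_cycle_inside S F)"
proof -
  have *: "Transposition.transpose a b \<circ> \<tau> \<in> no_cycle_inside (insert a S) (insert a F) \<longleftrightarrow> b \<in> S \<and> \<tau> \<in> no_cycle_inside S F"
    if b: "b \<in> insert a S" and \<tau>: "\<tau> permutes S" for b \<tau>
  proof -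
    let ?\<rho> = "Transposition.transpose a b \<circ> \<tau>"
    have \<rho>: "?\<rho> permutes insert a S"
      using b \<tau> by (intro permutes_compose permutes_swap_id) (auto intro: permutes_subset)
    have \<tau>a: "\<tau> a = a" using \<tau> S(2) by (rule permutes_not_in)
    have \<rho>a: "?\<rho> a = b" using \<tau>a by simp
    have na: "\<tau> x \<noteq> a" if "x \<noteq> a" for x
      using \<tau>a that permutes_inj[OF \<tau>] by (metis injD)
    show ?thesis
    proof (cases "b = a")
      case True
      then have "?\<rho> ` {a} \<subseteq> {a}" using \<tau>a by simp
      then have "?\<rho> \<notin> no_cycle_inside (insert a S) (insert a F)" unfolding no_cycle_inside_def by blast
      then show ?thesis using S(2) True by auto
    next
      case False
      have "?\<rho> \<in> no_cycle_inside (insert a S) (insert a F) \<longleftrightarrow> \<tau> \<in> no_cycle_inside S F"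
      proof
        assume L: "?\<rho> \<in> no_cycle_inside (insert a S) (insert a F)"
        \<comment> \<open>Inserting \<open>a\<close> enlarges the cycle of \<open>\<tau>\<close> through \<open>b\<close> and leaves the other cycles unchanged.\<close>
        have "B = {}" if B: "B \<subseteq> F" "\<tau> ` B \<subseteq> B" for B
        proof (cases "b \<in> B")
          case True
          have "?\<rho> ` insert a B \<subseteq> insert a B"
          proof
            fix y assume "y \<in> ?\<rho> ` insert a B"
            then obtain x where x: "x \<in> insert a B" "y = Transposition.transpose a b (\<tau> x)" by auto
            then have "\<tau> x \<in> insert a B" using B \<tau>a by auto
            then show "y \<in> insert a B" using x True by (auto simp: Transposition.transpose_def)
          qed
          moreover have "insert a B \<subseteq> insert a F" using B by auto
          ultimately have "insert a B = {}" using L unfolding no_cycle_inside_def by blast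
          then show ?thesis by simp
        next
          case nb: False
          have "?\<rho> ` B \<subseteq> B"
          proof
            fix y assume "y \<in> ?\<rho> ` B"
            then obtain x where x: "x \<in> B" "y = ?\<rho> x" by auto
            then have "\<tau> x \<in> B" "a \<notin> B" using B S by auto
            then have "\<tau> x \<noteq> a" "\<tau> x \<noteq> b" using nb by auto
            then show "y \<in> B" using x \<open>\<tau> x \<in> B\<close> by (simp add: transpose_def)
          qed
          moreover have "B \<subseteq> insert a F" using B by auto
          ultimately show ?thesis using L unfolding no_cycle_inside_def by blast
        qed
        then show "\<tau> \<in> no_cycle_inside S F" using \<tau> unfolding no_cycle_inside_def by blast
      next
        assume R: "\<tau> \<in> no_cycle_inside S F"
        \<comment> \<open>Deleting \<open>a\<close> leaves a set invariant under \<open>\<tau>\<close>; it is empty only if \<open>B\<close> is, as \<open>a\<close> is not a fixed point.\<close>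
        have "B = {}" if B: "B \<subseteq> insert a F" "?\<rho> ` B \<subseteq> B" for B
        proof -
          have inv: "?\<rho> x \<in> B \<longleftrightarrow> x \<in> B" for x
            using permutes_invariant_iff[OF \<rho> _ _ B(2)] S B(1) by auto
          have "\<tau> x \<in> B - {a}" if "x \<in> B - {a}" for x
          proof -
            have "\<tau> x \<noteq> a" using na that by simp
            moreover have "\<tau> x \<in> B"
            proof (cases "\<tau> x = b")
              case True
              then have "?\<rho> x = a" by simp
              then have "a \<in> B" using inv[of x] that by auto
              then show ?thesis using inv[of a] \<rho>a True by auto
            next
              case False
              then have "?\<rho> x = \<tau> x" using \<open>\<tau> x \<noteq> a\<close> by (simp add: transpose_def)
              then show ?thesis using inv[of x] that by auto
            qed
            ultimately show ?thesis by simp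
          qed
          then have "\<tau> ` (B - {a}) \<subseteq> B - {a}" by blast
          moreover have "B - {a} \<subseteq> F" using B by auto
          ultimately have "B - {a} = {}" using R unfolding no_cycle_inside_def by blast
          moreover have "B \<noteq> {a}" using inv[of a] \<rho>a False by auto
          ultimately show ?thesis by auto
        qed
        then show "?\<rho> \<in> no_cycle_inside (insert a S) (insert a F)"
          using \<rho> unfolding no_cycle_inside_def by blast
      qed
      then show ?thesis using b False by auto
    qed
  qed
  have "no_cycle_inside (insert a S) (insert a F) \<subseteq> {p. p permutes insert a S}"
    by (auto simp: no_cycle_inside_def)
  then have "no_cycle_inside (insert a S) (insert a F) =
      (\<lambda>(b, \<tau>). Transposition.transpose a b \<circ> \<tau>) ` {(b, \<tau>). b \<in> insert a S \<and> \<tau> permutes S \<and>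
        Transposition.transpose a b \<circ> \<tau> \<in> no_cycle_inside (insert a S) (insert a F)}"
    unfolding permutes_insert by (auto simp: image_iff) 
  also have "{(b, \<tau>). b \<in> insert a S \<and> \<tau> permutes S \<and>
        Transposition.transpose a b \<circ> \<tau> \<in> no_cycle_inside (insert a S) (insert a F)} = S \<times> no_cycle_inside S F"
    using * by (auto simp: no_cycle_inside_def[of S F])
  finally show ?thesis .
qed

lemma inj_on_transpose_comp:
  assumes "a \<notin> S"
  shows "inj_on (\<lambda>(b, \<tau>). Transposition.transpose a b \<circ> \<tau>) (B \<times> {\<tau>. \<tau> permutes S})"
proof (rule inj_onI, clarify)
  fix b \<tau> c \<rho> assume *: "\<tau> permutes S" "\<rho> permutes S" "Transposition.transpose a b \<circ> \<tau> = Transposition.transpose a c \<circ> \<rho>"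
  have "\<tau> a = a" "\<rho> a = a" using * assms by (auto intro: permutes_not_in)
  then have "b = c" using fun_cong[OF *(3), of a] by simp
  moreover have "\<tau> = \<rho>"
  proof
    fix x show "\<tau> x = \<rho> x"
      using fun_cong[OF *(3), of x] \<open>b = c\<close> by (metis comp_apply transpose_involutory)
  qed
  ultimately show "b = c \<and> \<tau> = \<rho>" by simp
qed

text \<open>By the previous lemma, adding a new element to both \<open>S\<close> and \<open>F\<close> multiplies the count by the old size
  of \<open>S\<close>, which keeps \<open>card S - card F\<close> unchanged and advances the factorial by one step.\<close>

lemma card_no_cycle_inside:
  assumes "finite S" "S \<noteq> {}" "F \<subseteq> S"
  shows "card (no_cycle_inside S F) = (card S - card F) * fact (card S - 1)"
proof -
  have "finite F" using assms finite_subset by blast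
  then show ?thesis using assms
  proof (induction F arbitrary: S)
    case empty
    have "no_cycle_inside S {} = {p. p permutes S}" by (auto simp: no_cycle_inside_def)
    then have "card (no_cycle_inside S {}) = fact (card S)"
      using card_permutations[OF refl empty.prems(1)] by simp
    also have "\<dots> = card S * fact (card S - 1)"
      using empty.prems by (subst fact_reduce) (auto simp: card_gt_0_iff)
    finally show ?case by simp
  next
    case (insert a F)
    define S' where "S' = S - {a}"
    have S: "S = insert a S'" "a \<notin> S'" "finite S'" "F \<subseteq> S'"
      using insert by (auto simp: S'_def)
    have "card (no_cycle_inside S (insert a F)) = card (S' \<times> no_cycle_inside S' F)"
      unfolding S(1) no_cycle_inside_insert[OF S(3,2,4)]
      by (intro card_image inj_on_subset[OF inj_on_transpose_comp[OF S(2)]])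
         (auto simp: no_cycle_inside_def)
    also have "\<dots> = card S' * card (no_cycle_inside S' F)" by (rule card_cartesian_product)
    also have "\<dots> = (card S - card (insert a F)) * fact (card S - 1)"
    proof (cases "S' = {}")
      case True
      then show ?thesis using S insert.hyps by auto
    next
      case False
      then have "card S' * card (no_cycle_inside S' F) = (card S' - card F) * (card S' * fact (card S' - 1))"
        using insert.IH[OF S(3) False S(4)] by simp
      also have "card S' * fact (card S' - 1) = fact (card S')"
        using False S(3) by (subst fact_reduce[of "card S'"]) (auto simp: card_gt_0_iff)
      finally show ?thesis using S insert.hyps by simp
    qed
    finally show ?case .
  qed
qed

lemma card_some_cycle_inside:
  assumes "finite S" "S \<noteq> {}" "F \<subseteq> S"
  shows "card {\<tau>. \<tau> permutes S \<and> (\<exists>B. B \<subseteq> F \<and> B \<noteq> {} \<and> \<tau> ` B \<subseteq> B)} = card F * fact (card S - 1)"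
proof -
  have "{\<tau>. \<tau> permutes S \<and> (\<exists>B. B \<subseteq> F \<and> B \<noteq> {} \<and> \<tau> ` B \<subseteq> B)} = {\<tau>. \<tau> permutes S} - no_cycle_inside S F"
    by (auto simp: no_cycle_inside_def)
  also have "card \<dots> = fact (card S) - (card S - card F) * fact (card S - 1)"
    using card_no_cycle_inside[OF assms] card_permutations[OF refl assms(1)] finite_permutations[OF assms(1)]
    by (subst card_Diff_subset) (auto simp: no_cycle_inside_def elim: rev_finite_subset)
  also have "fact (card S) = card S * (fact (card S - 1) :: nat)"
    using assms by (subst fact_reduce) (auto simp: card_gt_0_iff)
  also have "card S * fact (card S - 1) - (card S - card F) * fact (card S - 1) = card F * (fact (card S - 1) :: nat)"
    using card_mono[OF assms(1,3)] by (simp flip: diff_mult_distrib)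
  finally show ?thesis .
qed

section \<open>Sets preserved by a permutation\<close>

lemma card_stabilizer_le:
  assumes "finite S" "A \<subseteq> S"
  shows "card {\<tau>. \<tau> permutes S \<and> \<tau> ` A \<subseteq> A} \<le> fact (card A) * fact (card S - card A)"
proof -
  let ?P = "\<lambda>S. {\<tau>. \<tau> permutes S}"
  have fin: "finite A" "finite (S - A)" using assms finite_subset by auto
  have "{\<tau>. \<tau> permutes S \<and> \<tau> ` A \<subseteq> A} \<subseteq> (\<lambda>(g, h). g \<circ> h) ` (?P A \<times> ?P (S - A))"
  proof clarify
    fix \<tau> assume \<tau>: "\<tau> permutes S" "\<tau> ` A \<subseteq> A"
    have eq: "\<tau> x \<in> A \<longleftrightarrow> x \<in> A" for x using permutes_invariant_iff[OF \<tau>(1) assms \<tau>(2)] .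
    have A: "perm_restrict \<tau> A permutes A"
      using permutes_image_eq[OF \<tau>(1) assms \<tau>(2)] permutes_inj[OF \<tau>(1)]
      by (intro bij_imp_permutes) (auto simp: bij_betw_def perm_restrict_def inj_on_def)
    have "\<tau> ` (S - A) = S - A"
      using permutes_image_eq[OF \<tau>(1) assms \<tau>(2)] permutes_image[OF \<tau>(1)] permutes_inj[OF \<tau>(1)]
      by (simp add: image_set_diff)
    then have B: "perm_restrict \<tau> (S - A) permutes (S - A)"
      using permutes_inj[OF \<tau>(1)]
      by (intro bij_imp_permutes) (auto simp: bij_betw_def perm_restrict_def inj_on_def)
    have "perm_restrict \<tau> A \<circ> perm_restrict \<tau> (S - A) = perm_restrict \<tau> (A \<union> (S - A))"
      by (rule perm_restrict_union[OF A B]) auto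
    also have "A \<union> (S - A) = S" using assms by auto
    finally have "\<tau> = perm_restrict \<tau> A \<circ> perm_restrict \<tau> (S - A)"
      by (simp only: perm_restrict_id[OF \<tau>(1)])
    then show "\<tau> \<in> (\<lambda>(g, h). g \<circ> h) ` (?P A \<times> ?P (S - A))"
      using A B by (intro image_eqI[of _ _ "(perm_restrict \<tau> A, perm_restrict \<tau> (S - A))"]) auto
  qed
  then have "card {\<tau>. \<tau> permutes S \<and> \<tau> ` A \<subseteq> A} \<le> card (?P A \<times> ?P (S - A))"
    by (rule surj_card_le[rotated]) (auto intro: finite_permutations fin)
  also have "\<dots> = fact (card A) * fact (card S - card A)"
    using card_permutations[OF refl fin(1)] card_permutations[OF refl fin(2)] card_Diff_subset[OF fin(1) assms(2)]
    by (simp add: card_cartesian_product)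
  finally show ?thesis .
qed

lemma partition_orbits:
  assumes "\<sigma> permutes S" "finite S"
  shows "\<Union>(orbit \<sigma> ` S) = S" "disjoint (orbit \<sigma> ` S)" "\<And>x. x \<in> S \<Longrightarrow> x \<in> orbit \<sigma> x"
proof -
  have "permutation \<sigma>" using assms by (auto simp: permutation_permutes)
  then show self: "x \<in> orbit \<sigma> x" for x by (rule permutation_self_in_orbit)
  then show "\<Union>(orbit \<sigma> ` S) = S" using permutes_orbit_subset[OF assms(1)] by blast
  have "orbit \<sigma> x = orbit \<sigma> y" if "z \<in> orbit \<sigma> x" "z \<in> orbit \<sigma> y" for x y z
    using that orbit_cyclic_eq3[OF cyclic_on_orbit[OF assms]] by metis
  then show "disjoint (orbit \<sigma> ` S)" unfolding disjoint_def by blast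
qed

lemma invariant_orbit_subset:
  assumes "\<sigma> ` A \<subseteq> A" "x \<in> A"
  shows "orbit \<sigma> x \<subseteq> A"
proof
  fix y assume "y \<in> orbit \<sigma> x"
  then show "y \<in> A" by induction (use assms in auto)
qed

text \<open>The sum of \<open>card X choose j\<close> over \<open>j \<le> r\<close> has no closed form, but weighting its terms by
  \<open>r choose (r - j) \<ge> 1\<close> turns it into Vandermonde's identity.\<close>

lemma card_small_subsets_le:
  assumes "finite X"
  shows "card {P. P \<subseteq> X \<and> card P \<le> r} \<le> (card X + r) choose r"
proof -
  have "{P. P \<subseteq> X \<and> card P \<le> r} = (\<Union>j\<le>r. {P. P \<subseteq> X \<and> card P = j})" by auto
  also have "card \<dots> \<le> (\<Sum>j\<le>r. card {P. P \<subseteq> X \<and> card P = j})" by (rule card_UN_le) simp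
  also have "\<dots> = (\<Sum>j\<le>r. card X choose j)" using n_subsets[OF assms] by simp
  also have "\<dots> \<le> (\<Sum>j\<le>r. (card X choose j) * (r choose (r - j)))"
    by (intro sum_mono) (auto simp: Suc_le_eq)
  also have "\<dots> = (card X + r) choose r" by (rule vandermonde)
  finally show ?thesis .
qed

text \<open>An invariant set is determined by the orbits it contains. If it has \<open>Suc r\<close> elements, not all of them
  fixed, then a point and its image share an orbit, so it consists of at most \<open>r\<close> orbits.\<close>

lemma card_invariant_sets_le:
  assumes \<sigma>: "\<sigma> permutes S" and S: "finite S"
  shows "card {A. A \<subseteq> S \<and> \<sigma> ` A \<subseteq> A \<and> \<not> A \<subseteq> {x. \<sigma> x = x} \<and> card A = Suc r}
    \<le> (card (orbit \<sigma> ` S) + r) choose r"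
proof -
  let ?O = "orbit \<sigma> ` S"
  let ?\<A> = "{A. A \<subseteq> S \<and> \<sigma> ` A \<subseteq> A \<and> \<not> A \<subseteq> {x. \<sigma> x = x} \<and> card A = Suc r}"
  note orbits = partition_orbits[OF \<sigma> S]
  have Un: "\<Union>(orbit \<sigma> ` A) = A" if "A \<subseteq> S" "\<sigma> ` A \<subseteq> A" for A
    using invariant_orbit_subset[OF that(2)] orbits(3) that(1) by blast
  have "card (orbit \<sigma> ` A) \<le> r" if "A \<in> ?\<A>" for A
  proof -
    have A: "A \<subseteq> S" "\<sigma> ` A \<subseteq> A" "\<not> A \<subseteq> {x. \<sigma> x = x}" "card A = Suc r" using that by auto
    have fin: "finite A" using A(1) S finite_subset by blast
    obtain x where x: "x \<in> A" "\<sigma> x \<noteq> x" using A(3) by blast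
    have "\<sigma> x \<in> A" using x A(2) by blast
    have "orbit \<sigma> (\<sigma> x) = orbit \<sigma> x"
      by (rule orbit_cyclic_eq3[OF cyclic_on_orbit[OF \<sigma> S] orbit.base])
    \<comment> \<open>The image of \<open>x\<close> is dropped: it lies in the orbit of \<open>x\<close>, so no orbit is lost.\<close>
    then have "orbit \<sigma> ` A = orbit \<sigma> ` (A - {\<sigma> x})" 
    proof (intro equalityI subsetI)
      fix O' assume "O' \<in> orbit \<sigma> ` A"
      then obtain y where "y \<in> A" "O' = orbit \<sigma> y" by auto
      then show "O' \<in> orbit \<sigma> ` (A - {\<sigma> x})"
        using x \<open>orbit \<sigma> (\<sigma> x) = orbit \<sigma> x\<close> by (cases "y = \<sigma> x") auto
    qed auto
    then have "card (orbit \<sigma> ` A) \<le> card (A - {\<sigma> x})" using fin by (simp add: card_image_le)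
    then show ?thesis using A(4) \<open>\<sigma> x \<in> A\<close> fin by simp
  qed
  then have "(\<lambda>A. orbit \<sigma> ` A) ` ?\<A> \<subseteq> {P. P \<subseteq> ?O \<and> card P \<le> r}"
    by auto
  moreover have "inj_on (\<lambda>A. orbit \<sigma> ` A) ?\<A>"
    by (rule inj_on_inverseI[of _ Union]) (use Un in auto)
  ultimately have "card ?\<A> \<le> card {P. P \<subseteq> ?O \<and> card P \<le> r}"
    using S by (intro card_inj_on_le) auto
  also have "\<dots> \<le> (card ?O + r) choose r"
    by (rule card_small_subsets_le) (use S in simp)
  finally show ?thesis .
qed

section \<open>The sum over block sizes\<close>

text \<open>Factor by factor, \<open>(m - i) / (n - i) \<le> m / n\<close>; the form without division is proved by induction.\<close>

lemma choose_ratio_le: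
  assumes "m \<le> n"
  shows "(m choose r) * n ^ r \<le> (n choose r) * m ^ r"
proof (induction r)
  case 0
  show ?case by simp
next
  case (Suc r)
  have rec: "Suc r * (a choose Suc r) = (a - r) * (a choose r)" for a :: nat
    using binomial_absorption[of r a] binomial_absorb_comp[of a r] by simp
  have "(m - r) * n \<le> (n - r) * m"
    unfolding diff_mult_distrib mult.commute[of n m] using assms by (intro diff_le_mono2) simp
  then have "((m - r) * n) * ((m choose r) * n ^ r) \<le> ((n - r) * m) * ((n choose r) * m ^ r)"
    using Suc.IH by (rule mult_le_mono)
  then have "Suc r * ((m choose Suc r) * n ^ Suc r) \<le> Suc r * ((n choose Suc r) * m ^ Suc r)"
    using rec[of m] rec[of n] by (metis (no_types, lifting) mult.assoc mult.commute power_Suc)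
  then show ?case by (simp only: mult_le_cancel1)
qed

lemma summable_square_times_geometric: "summable (\<lambda>r. (real r + 1)^2 * (3/4) ^ (r - 1))"
proof (rule summable_comparison_test_bigo)
  show "summable (\<lambda>r. norm ((4/5) ^ r :: real))" by (simp add: summable_geometric)
  show "(\<lambda>r. (real r + 1)^2 * (3/4) ^ (r - 1)) \<in> O(\<lambda>r. (4/5) ^ r)" by real_asymp
qed

text \<open>The union bound for the probability that a random permutation preserves some set of size \<open>r + 1\<close>
  with \<open>2 \<le> r + 1 \<le> n / 2\<close>, out of at most \<open>(k + r) choose r\<close> candidates for each size.\<close>

definition block_union_bound :: "nat \<Rightarrow> nat \<Rightarrow> real" where
  "block_union_bound n k = (\<Sum>r = 1..<n div 2. real ((k + r) choose r) / real (n choose Suc r))"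

text \<open>Since \<open>(n choose Suc r) = (n - r) / (r + 1) * (n choose r)\<close>, the term for \<open>r\<close> is at most
  \<open>2 * (r + 1) / n * ((k + r) / n) ^ r\<close>. One of the \<open>r\<close> factors \<open>(k + r) / n\<close> is bounded by
  \<open>k * (r + 1) / n\<close>, which supplies the decay \<open>k / n\<^sup>2\<close>; the others are at most \<open>1 / 4 + 1 / 2\<close>, which
  makes the sum converge.\<close>

lemma block_union_bound_le:
  "\<exists>C\<ge>0. \<forall>n k. 1 \<le> k \<longrightarrow> 4 * k \<le> n \<longrightarrow> block_union_bound n k \<le> C * real k / real n ^ 2"
proof -
  define w where "w r = (real r + 1)^2 * (3/4) ^ (r - 1)" for r
  have w: "summable w" "\<And>r. w r \<ge> 0"
    using summable_square_times_geometric unfolding w_def by auto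
  have "block_union_bound n k \<le> (2 * suminf w) * real k / real n ^ 2"
    if k: "1 \<le> k" "4 * k \<le> n" for n k
  proof -
    have "real ((k + r) choose r) / real (n choose Suc r) \<le> (2 * real k / real n ^ 2) * w r"
      if r: "r \<in> {1..<n div 2}" for r
    proof -
      have rn: "1 \<le> r" "2 * r < n" using r by auto
      have n: "real n > 0" using k by simp
      define t where "t = (real k + real r) / real n"
      have "Suc r * (n choose Suc r) = (n - r) * (n choose r)"
        using binomial_absorption[of r n] binomial_absorb_comp[of n r] by simp
      then have "real (Suc r) * real (n choose Suc r) = real (n - r) * real (n choose r)"
        by (metis of_nat_mult)
      moreover have "real n / 2 * real (n choose r) \<le> real (n - r) * real (n choose r)"
        using rn by (intro mult_right_mono) auto
      ultimately have lower: "real n / 2 * real (n choose r) \<le> (real r + 1) * real (n choose Suc r)"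
        by (simp add: add.commute[of "real r"])
      have "k + r \<le> n" using k rn by linarith
      then have "real ((k + r) choose r) * real n ^ r \<le> real (n choose r) * (real k + real r) ^ r"
        using choose_ratio_le[of "k + r" n r] by (metis of_nat_add of_nat_le_iff of_nat_mult of_nat_power)
      then have up: "real ((k + r) choose r) \<le> real (n choose r) * t ^ r"
        using n by (simp add: t_def power_divide field_simps)
      have pos: "real (n choose r) > 0" "real (n choose Suc r) > 0" using rn by auto
      have "t ^ r = t * t ^ (r - 1)" using rn by (simp flip: power_Suc)
      also have "\<dots> \<le> (real k * (real r + 1) / real n) * (3/4) ^ (r - 1)"
      proof (intro mult_mono power_mono)
        have "1 * real r \<le> real k * real r" using k by (intro mult_right_mono) auto
        then show "t \<le> real k * (real r + 1) / real n"
          unfolding t_def using n by (intro divide_right_mono) (auto simp: algebra_simps)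
        have "4 * k + 4 * r \<le> 3 * n" using k rn by linarith
        then have "real (4 * k + 4 * r) \<le> real (3 * n)" by (rule of_nat_mono)
        then show "t \<le> 3/4" using n by (simp add: t_def field_simps)
      qed (auto simp: t_def)
      finally have tr: "t ^ r \<le> (real k * (real r + 1) / real n) * (3/4) ^ (r - 1)" .
      have "real ((k + r) choose r) / real (n choose Suc r) \<le> (real (n choose r) * t ^ r) / real (n choose Suc r)"
        using up pos by (intro divide_right_mono) auto
      also have "\<dots> \<le> (2 * (real r + 1) / real n) * t ^ r"
      proof -
        have "0 \<le> t ^ r" by (simp add: t_def)
        then have "real n / 2 * real (n choose r) * t ^ r \<le> (real r + 1) * real (n choose Suc r) * t ^ r"
          using lower by (intro mult_right_mono)
        then show ?thesis using n pos by (simp add: field_simps)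
      qed
      also have "(2 * (real r + 1) / real n) * t ^ r \<le>
          (2 * (real r + 1) / real n) * ((real k * (real r + 1) / real n) * (3/4) ^ (r - 1))"
        by (rule mult_left_mono[OF tr]) simp
      also have "\<dots> = (2 * real k / real n ^ 2) * w r"
        by (simp add: w_def power2_eq_square)
      finally show ?thesis .
    qed
    then have "block_union_bound n k \<le> (\<Sum>r = 1..<n div 2. (2 * real k / real n ^ 2) * w r)"
      unfolding block_union_bound_def by (rule sum_mono)
    also have "\<dots> = (2 * real k / real n ^ 2) * (\<Sum>r = 1..<n div 2. w r)"
      by (simp add: sum_distrib_left)
    also have "\<dots> \<le> (2 * real k / real n ^ 2) * suminf w"
      using w by (intro mult_left_mono sum_le_suminf) auto
    also have "\<dots> \<le> (2 * suminf w) * real k / real n ^ 2"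
      by (simp add: field_simps)
    finally show ?thesis .
  qed
  moreover have "2 * suminf w \<ge> 0" using suminf_nonneg[OF w] by simp
  ultimately show ?thesis by blast
qed

section \<open>Counting intransitive pairs\<close>

lemma intransitive_half:
  assumes \<sigma>: "\<sigma> permutes S" and \<tau>: "\<tau> permutes S" and S: "finite S" and intr: "intransitive S \<sigma> \<tau>"
  obtains D where "D \<noteq> {}" "D \<subset> S" "\<sigma> ` D \<subseteq> D" "\<tau> ` D \<subseteq> D" "card D \<le> card S div 2"
proof -
  obtain A where A: "A \<noteq> {}" "A \<subset> S" "\<sigma> ` A \<subseteq> A" "\<tau> ` A \<subseteq> A"
    using intr by (auto simp: intransitive_def)
  have sub: "A \<subseteq> S" using A(2) by blast
  have compl: "\<rho> ` (S - A) \<subseteq> S - A" if "\<rho> permutes S" "\<rho> ` A \<subseteq> A" for \<rho>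
    using permutes_invariant_iff[OF that(1) S sub that(2)] permutes_in_image[OF that(1)] by auto
  have "card A + card (S - A) = card S"
    using S sub by (metis card_Diff_subset card_mono finite_subset le_add_diff_inverse)
  then consider "card A \<le> card S div 2" | "card (S - A) \<le> card S div 2" by linarith
  then show thesis
  proof cases
    case 1
    show thesis by (rule that[OF A 1])
  next
    case 2
    have "S - A \<noteq> {}" "S - A \<subset> S" using A(1,2) by blast+
    then show thesis
      by (rule that[OF _ _ compl[OF \<sigma> A(3)] compl[OF \<tau> A(4)] 2])
  qed
qed

text \<open>A common invariant set of at most half the size either lies inside the fixed points of \<open>\<sigma>\<close>, and then
  \<open>\<tau>\<close> has a cycle there, or it contains a point moved by \<open>\<sigma>\<close> and has at least two elements.\<close>

lemma card_intransitive_partners_le: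
  assumes \<sigma>: "\<sigma> permutes S" and S: "finite S" "S \<noteq> {}"
  shows "card {\<tau>. \<tau> permutes S \<and> intransitive S \<sigma> \<tau>} \<le>
    card {x \<in> S. \<sigma> x = x} * fact (card S - 1) +
    (\<Sum>r = 1..<card S div 2. ((card (orbit \<sigma> ` S) + r) choose r) * (fact (Suc r) * fact (card S - Suc r)))"
proof -
  let ?F = "{x \<in> S. \<sigma> x = x}"
  let ?I = "{\<tau>. \<tau> permutes S \<and> (\<exists>B. B \<subseteq> ?F \<and> B \<noteq> {} \<and> \<tau> ` B \<subseteq> B)}"
  let ?\<A> = "\<lambda>r. {A. A \<subseteq> S \<and> \<sigma> ` A \<subseteq> A \<and> \<not> A \<subseteq> {x. \<sigma> x = x} \<and> card A = Suc r}"
  let ?Stab = "\<lambda>A. {\<tau>. \<tau> permutes S \<and> \<tau> ` A \<subseteq> A}"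
  let ?R = "{1..<card S div 2}"
  let ?U = "\<Union>r\<in>?R. \<Union>A\<in>?\<A> r. ?Stab A"
  have fin\<A>: "finite (?\<A> r)" for r using S(1) by (auto intro: finite_subset[of _ "Pow S"])
  have fin: "finite {\<tau>. \<tau> permutes S}" using S(1) by (rule finite_permutations)
  have "{\<tau>. \<tau> permutes S \<and> intransitive S \<sigma> \<tau>} \<subseteq> ?I \<union> ?U"
  proof clarify
    fix \<tau> assume \<tau>: "\<tau> permutes S" "intransitive S \<sigma> \<tau>" "\<tau> \<notin> ?U"
    obtain D where D: "D \<noteq> {}" "D \<subset> S" "\<sigma> ` D \<subseteq> D" "\<tau> ` D \<subseteq> D" "card D \<le> card S div 2"
      using intransitive_half[OF \<sigma> \<tau>(1) S(1) \<tau>(2)] .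
    have "D \<subseteq> ?F"
    proof (rule ccontr)
      assume nD: "\<not> D \<subseteq> ?F"
      then obtain x where x: "x \<in> D" "\<sigma> x \<noteq> x" using D(2) by blast
      have "finite D" using D(2) S(1) by (metis finite_subset psubset_imp_subset)
      moreover have "{x, \<sigma> x} \<subseteq> D" using x D(3) by blast
      ultimately have "card {x, \<sigma> x} \<le> card D" by (rule card_mono)
      then have "2 \<le> card D" using x(2) by simp
      then have "card D - 1 \<in> ?R" "card D = Suc (card D - 1)" using D(5) by auto
      moreover have "D \<in> ?\<A> (card D - 1)" using calculation(2) D x by auto
      moreover have "\<tau> \<in> ?Stab D" using \<tau>(1) D(4) by blast
      ultimately show False using \<tau>(3) by blast
    qed
    then show "\<exists>B. B \<subseteq> ?F \<and> B \<noteq> {} \<and> \<tau> ` B \<subseteq> B" using D by blast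
  qed
  then have "card {\<tau>. \<tau> permutes S \<and> intransitive S \<sigma> \<tau>} \<le> card (?I \<union> ?U)"
    by (rule card_mono[rotated]) (auto intro: finite_subset[OF _ fin])
  also have "\<dots> \<le> card ?I + card ?U" by (rule card_Un_le)
  also have "card ?I = card ?F * fact (card S - 1)"
    using S by (intro card_some_cycle_inside) auto
  also have "card ?U \<le> (\<Sum>r\<in>?R. card (\<Union>A\<in>?\<A> r. ?Stab A))" by (rule card_UN_le) simp
  also have "\<dots> \<le> (\<Sum>r\<in>?R. ((card (orbit \<sigma> ` S) + r) choose r) * (fact (Suc r) * fact (card S - Suc r)))"
  proof (rule sum_mono)
    fix r
    have "card (\<Union>A\<in>?\<A> r. ?Stab A) \<le> (\<Sum>A\<in>?\<A> r. card (?Stab A))"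
      using fin\<A> by (rule card_UN_le)
    also have "\<dots> \<le> (\<Sum>A\<in>?\<A> r. fact (Suc r) * fact (card S - Suc r))"
    proof (rule sum_mono)
      fix A assume "A \<in> ?\<A> r"
      then have A: "A \<subseteq> S" "card A = Suc r" by simp_all
      show "card (?Stab A) \<le> fact (Suc r) * fact (card S - Suc r)"
        using card_stabilizer_le[OF S(1) A(1)] unfolding A(2) .
    qed
    also have "\<dots> = card (?\<A> r) * (fact (Suc r) * fact (card S - Suc r))" by simp
    also have "\<dots> \<le> ((card (orbit \<sigma> ` S) + r) choose r) * (fact (Suc r) * fact (card S - Suc r))"
      using card_invariant_sets_le[OF \<sigma> S(1)] by (rule mult_le_mono1)
    finally show "card (\<Union>A\<in>?\<A> r. ?Stab A) \<le> \<dots>" .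
  qed
  finally show ?thesis by simp
qed

lemma card_intransitive_pairs_le:
  assumes S: "finite S"
  shows "card {(\<sigma>, \<tau>). \<sigma> permutes S \<and> \<tau> permutes S \<and> intransitive S \<sigma> \<tau>} \<le>
    (\<Sum>s = 1..card S div 2. (card S choose s) * (fact s * fact (card S - s)) ^ 2)"
proof -
  let ?Stab = "\<lambda>A. {\<tau>. \<tau> permutes S \<and> \<tau> ` A \<subseteq> A}"
  let ?\<A> = "\<lambda>s. {A. A \<subseteq> S \<and> card A = s}"
  let ?U = "\<Union>s\<in>{1..card S div 2}. \<Union>A\<in>?\<A> s. ?Stab A \<times> ?Stab A"
  have fin: "finite {\<tau>. \<tau> permutes S}" using S by (rule finite_permutations)
  have "{(\<sigma>, \<tau>). \<sigma> permutes S \<and> \<tau> permutes S \<and> intransitive S \<sigma> \<tau>} \<subseteq> ?U"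
  proof clarify
    fix \<sigma> \<tau> assume *: "\<sigma> permutes S" "\<tau> permutes S" "intransitive S \<sigma> \<tau>"
    obtain D where D: "D \<noteq> {}" "D \<subset> S" "\<sigma> ` D \<subseteq> D" "\<tau> ` D \<subseteq> D" "card D \<le> card S div 2"
      using intransitive_half[OF *(1,2) S *(3)] .
    have "finite D" using D(2) S by (metis finite_subset psubset_imp_subset)
    then have "card D \<in> {1..card S div 2}" using D(1,5) by (auto simp: Suc_le_eq card_gt_0_iff)
    moreover have "D \<in> ?\<A> (card D)" "(\<sigma>, \<tau>) \<in> ?Stab D \<times> ?Stab D" using D * by auto
    ultimately show "(\<sigma>, \<tau>) \<in> ?U" by blast
  qed
  then have "card {(\<sigma>, \<tau>). \<sigma> permutes S \<and> \<tau> permutes S \<and> intransitive S \<sigma> \<tau>} \<le> card ?U"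
    by (rule card_mono[rotated])
       (auto intro: finite_subset[OF _ finite_cartesian_product[OF fin fin]])
  also have "\<dots> \<le> (\<Sum>s = 1..card S div 2. card (\<Union>A\<in>?\<A> s. ?Stab A \<times> ?Stab A))"
    by (rule card_UN_le) simp
  also have "\<dots> \<le> (\<Sum>s = 1..card S div 2. (card S choose s) * (fact s * fact (card S - s)) ^ 2)"
  proof (rule sum_mono)
    fix s
    have "card (\<Union>A\<in>?\<A> s. ?Stab A \<times> ?Stab A) \<le> (\<Sum>A\<in>?\<A> s. card (?Stab A \<times> ?Stab A))"
      using S by (intro card_UN_le) (auto intro: finite_subset[of _ "Pow S"])
    also have "\<dots> \<le> (\<Sum>A\<in>?\<A> s. (fact s * fact (card S - s)) ^ 2)"
    proof (rule sum_mono)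
      fix A assume "A \<in> ?\<A> s"
      then have "card (?Stab A) \<le> fact s * fact (card S - s)" using card_stabilizer_le[OF S] by auto
      then show "card (?Stab A \<times> ?Stab A) \<le> (fact s * fact (card S - s)) ^ 2"
        unfolding card_cartesian_product power2_eq_square by (intro mult_le_mono)
    qed
    also have "\<dots> = (card S choose s) * (fact s * fact (card S - s)) ^ 2"
      using n_subsets[OF S] by simp
    finally show "card (\<Union>A\<in>?\<A> s. ?Stab A \<times> ?Stab A) \<le> \<dots>" .
  qed
  finally show ?thesis .
qed

lemma sum_card_fixed_points:
  assumes "finite S" "S \<noteq> {}"
  shows "(\<Sum>\<sigma> | \<sigma> permutes S. card {x \<in> S. \<sigma> x = x}) = fact (card S)"
proof -
  let ?P = "{\<sigma>. \<sigma> permutes S}"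
  have fin: "finite ?P" using assms(1) by (rule finite_permutations)
  \<comment> \<open>Swapping the summations counts, for each point, the permutations fixing it.\<close>
  have "(\<Sum>\<sigma>\<in>?P. card {x \<in> S. \<sigma> x = x}) = (\<Sum>x\<in>S. card {\<sigma> \<in> ?P. \<sigma> x = x})"
    unfolding card_eq_sum by (rule sum.swap_restrict[OF fin assms(1)])
  also have "\<dots> = (\<Sum>x\<in>S. fact (card S - 1))"
  proof (rule sum.cong[OF refl])
    fix x assume x: "x \<in> S"
    have "{\<sigma> \<in> ?P. \<sigma> x = x} = {\<sigma>. \<sigma> permutes S - {x}}"
    proof (intro equalityI subsetI)
      fix \<sigma> assume "\<sigma> \<in> {\<sigma> \<in> ?P. \<sigma> x = x}"
      then show "\<sigma> \<in> {\<sigma>. \<sigma> permutes S - {x}}" by (auto intro: permutes_superset[of \<sigma> S])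
    next
      fix \<sigma> assume "\<sigma> \<in> {\<sigma>. \<sigma> permutes S - {x}}"
      then show "\<sigma> \<in> {\<sigma> \<in> ?P. \<sigma> x = x}"
        by (auto intro: permutes_subset[of \<sigma> "S - {x}"] permutes_not_in[of \<sigma> "S - {x}"])
    qed
    then show "card {\<sigma> \<in> ?P. \<sigma> x = x} = fact (card S - 1)"
      using card_permutations[of "S - {x}" "card S - 1"] assms(1) x by simp
  qed
  also have "\<dots> = card S * fact (card S - 1)" by simp
  also have "\<dots> = fact (card S)"
    using assms by (subst fact_reduce[of "card S"]) (auto simp: card_gt_0_iff)
  finally show ?thesis .
qed

text \<open>For \<open>\<sigma> \<noteq> id\<close>, a cycle of \<open>\<tau>\<close> inside the fixed points of \<open>\<sigma>\<close> is a common invariant set and is proper.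
  The number of such \<open>\<tau>\<close> is proportional to the number of fixed points of \<open>\<sigma>\<close>, whose total is known;
  the identity has to be left out because \<open>\<tau>\<close> may be a single cycle, and this costs the term \<open>card S\<close>.\<close>

lemma card_intransitive_pairs_ge:
  assumes S: "finite S" "S \<noteq> {}"
  shows "(fact (card S) - card S) * fact (card S - 1) \<le>
    card {(\<sigma>, \<tau>). \<sigma> permutes S \<and> \<tau> permutes S \<and> intransitive S \<sigma> \<tau>}"
proof -
  let ?P = "{\<sigma>. \<sigma> permutes S}" and ?F = "\<lambda>\<sigma>. {x \<in> S. \<sigma> x = x}"
  let ?I = "\<lambda>\<sigma>. {\<tau>. \<tau> permutes S \<and> (\<exists>B. B \<subseteq> ?F \<sigma> \<and> B \<noteq> {} \<and> \<tau> ` B \<subseteq> B)}"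
  have fin: "finite ?P" using S(1) by (rule finite_permutations)
  have "(\<Sum>\<sigma>\<in>?P. card (?F \<sigma>)) = card (?F id) + (\<Sum>\<sigma>\<in>?P - {id}. card (?F \<sigma>))"
    by (rule sum.remove[OF fin]) (unfold mem_Collect_eq, rule permutes_id)
  then have "(fact (card S) - card S) * fact (card S - 1) = (\<Sum>\<sigma>\<in>?P - {id}. card (?F \<sigma>)) * fact (card S - 1)"
    using sum_card_fixed_points[OF S] by simp
  also have "\<dots> = (\<Sum>\<sigma>\<in>?P - {id}. card (?I \<sigma>))"
    unfolding sum_distrib_right using S by (intro sum.cong refl card_some_cycle_inside[symmetric]) auto
  also have "\<dots> = card (Sigma (?P - {id}) ?I)"
    using fin by (intro card_SigmaI[symmetric]) (auto intro: finite_subset[OF _ fin])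
  also have "\<dots> \<le> card {(\<sigma>, \<tau>). \<sigma> permutes S \<and> \<tau> permutes S \<and> intransitive S \<sigma> \<tau>}"
  proof (rule card_mono)
    show "finite {(\<sigma>, \<tau>). \<sigma> permutes S \<and> \<tau> permutes S \<and> intransitive S \<sigma> \<tau>}"
      by (rule finite_subset[OF _ finite_cartesian_product[OF fin fin]]) auto
    show "Sigma (?P - {id}) ?I \<subseteq> {(\<sigma>, \<tau>). \<sigma> permutes S \<and> \<tau> permutes S \<and> intransitive S \<sigma> \<tau>}"
    proof
      fix p assume "p \<in> Sigma (?P - {id}) ?I"
      then obtain \<sigma> \<tau> B where p: "p = (\<sigma>, \<tau>)" and *: "\<sigma> permutes S" "\<sigma> \<noteq> id" "\<tau> permutes S"
        "B \<subseteq> ?F \<sigma>" "B \<noteq> {}" "\<tau> ` B \<subseteq> B" by blast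
      have "?F \<sigma> \<noteq> S"
      proof
        assume "?F \<sigma> = S"
        then have "\<sigma> x = x" for x using permutes_not_in[OF *(1), of x] by blast
        then show False using *(2) by auto
      qed
      then have "B \<subset> S" using *(4) by blast
      moreover have "\<sigma> ` B \<subseteq> B" using *(4) by auto
      ultimately show "p \<in> {(\<sigma>, \<tau>). \<sigma> permutes S \<and> \<tau> permutes S \<and> intransitive S \<sigma> \<tau>}"
        using * p unfolding intransitive_def by blast
    qed
  qed
  finally show ?thesis .
qed

section \<open>Probabilities\<close>

lemma prob_connected_eq:
  assumes "K \<subseteq> sym_perms n" "K \<noteq> {}"
  shows "prob_connected n (K \<times> sym_perms n) = 1 -
    real (card {(\<sigma>, \<tau>). \<sigma> \<in> K \<and> \<tau> permutes {1..n} \<and> intransitive {1..n} \<sigma> \<tau>}) / (real (card K) * fact n)"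
proof -
  let ?D = "{(\<sigma>, \<tau>). \<sigma> \<in> K \<and> \<tau> permutes {1..n} \<and> intransitive {1..n} \<sigma> \<tau>}"
  let ?A = "K \<times> sym_perms n"
  have "finite (sym_perms n)" unfolding sym_perms_def by (rule finite_permutations) simp
  then have fin: "finite ?A" "finite K" using assms(1) finite_subset by auto
  have "id \<in> sym_perms n" by (simp add: sym_perms_def permutes_id)
  then have ne: "?A \<noteq> {}" using assms(2) by auto
  have sub: "?D \<subseteq> ?A" by (auto simp: sym_perms_def)
  have "?A \<inter> {(\<sigma>, \<tau>). connected_space (square_tiled_surface n \<sigma> \<tau>)} = ?A - ?D"
    using assms(1) connected_iff_not_intransitive by (fastforce simp: sym_perms_def)
  then have "prob_connected n ?A = real (card (?A - ?D)) / real (card ?A)"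
    unfolding prob_connected_def measure_pmf_of_set[OF ne fin(1)] by simp
  also have "card (?A - ?D) = card ?A - card ?D"
    using sub fin(1) finite_subset by (intro card_Diff_subset) auto
  also have "real (card ?A - card ?D) = real (card ?A) - real (card ?D)"
    using card_mono[OF fin(1) sub] by (rule of_nat_diff)
  also have "card ?A = card K * fact n"
    using card_permutations[of "{1..n}" n] by (simp add: card_cartesian_product sym_perms_def)
  also have "(real (card K * fact n) - real (card ?D)) / real (card K * fact n) =
      1 - real (card ?D) / (real (card K) * fact n)"
    using fin(2) assms(2) by (simp add: diff_divide_distrib)
  finally show ?thesis .
qed

lemma prob_connected_pairs_eq:
  "prob_connected n (sym_perms n \<times> sym_perms n) = 1 -
    real (card {(\<sigma>, \<tau>). \<sigma> permutes {1..n} \<and> \<tau> permutes {1..n} \<and> intransitive {1..n} \<sigma> \<tau>}) / (fact n)\<^sup>2"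
proof -
  have ne: "sym_perms n \<noteq> {}" using permutes_id unfolding sym_perms_def by blast
  have "card (sym_perms n) = fact n"
    unfolding sym_perms_def by (rule card_permutations) simp_all
  then show ?thesis
    using prob_connected_eq[OF subset_refl ne] by (simp add: power2_eq_square sym_perms_def)
qed

text \<open>The sets of size 1 contribute \<open>1 / n\<close> to the union bound. For the larger ones, \<open>1 / (n choose s)\<close> is at
  most the corresponding term of the bound \<open>block_union_bound n 1\<close>.\<close>

lemma prob_connected_pairs_ge:
  assumes n: "2 \<le> n"
  shows "prob_connected n (sym_perms n \<times> sym_perms n) \<ge> 1 - 1 / real n - block_union_bound n 1"
proof -
  let ?D = "{(\<sigma>, \<tau>). \<sigma> permutes {1..n} \<and> \<tau> permutes {1..n} \<and> intransitive {1..n} \<sigma> \<tau>}"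
  have term_eq: "real ((n choose s) * (fact s * fact (n - s)) ^ 2) / (fact n)\<^sup>2 = 1 / real (n choose s)"
    if "s \<le> n" for s
  proof -
    have "(fact n :: real) = fact s * fact (n - s) * real (n choose s)"
      using binomial_fact_lemma[OF that] by (metis of_nat_fact of_nat_mult)
    moreover have "real (n choose s) > 0" using that by simp
    ultimately show ?thesis by (simp add: power2_eq_square field_simps)
  qed
  have "real (card ?D) / (fact n)\<^sup>2 \<le>
      real (\<Sum>s = 1..n div 2. (n choose s) * (fact s * fact (n - s)) ^ 2) / (fact n)\<^sup>2"
    using card_intransitive_pairs_le[of "{1..n}"] by (intro divide_right_mono of_nat_mono) auto
  also have "\<dots> = (\<Sum>s = 1..n div 2. 1 / real (n choose s))"
    unfolding of_nat_sum sum_divide_distrib by (intro sum.cong refl term_eq) auto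
  also have "{1..n div 2} = insert 1 {Suc 1..<Suc (n div 2)}" using n by auto
  also have "(\<Sum>s\<in>insert 1 {Suc 1..<Suc (n div 2)}. 1 / real (n choose s)) =
      1 / real n + (\<Sum>r = 1..<n div 2. 1 / real (n choose Suc r))"
    by (subst sum.insert) (simp_all only: sum.shift_bounds_Suc_ivl, auto)
  also have "(\<Sum>r = 1..<n div 2. 1 / real (n choose Suc r)) \<le>
      (\<Sum>r = 1..<n div 2. real ((1 + r) choose r) / real (n choose Suc r))"
    by (intro sum_mono divide_right_mono) auto
  finally have "real (card ?D) / (fact n)\<^sup>2 \<le> 1 / real n + block_union_bound n 1"
    by (simp only: block_union_bound_def)
  moreover note prob_connected_pairs_eq[of n]
  ultimately show ?thesis by simp
qed

lemma square_le_fact: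
  assumes "4 \<le> n"
  shows "n ^ 2 \<le> fact n"
  using assms
proof (induction n rule: dec_induct)
  case base
  show ?case by (simp add: fact_numeral)
next
  case (step n)
  have "n * 2 \<le> n * n" using step(1) by (intro mult_le_mono2) simp
  then have "Suc n \<le> n ^ 2" unfolding power2_eq_square using step(1) by linarith
  then have "Suc n * Suc n \<le> Suc n * fact n" using step(3) by (intro mult_le_mono) auto
  then show ?case by (simp add: power2_eq_square)
qed

text \<open>Leaving out \<open>\<sigma> = id\<close> in the count of disconnected pairs costs \<open>1 / fact n\<close>, which is absorbed in
  \<open>1 / n\<^sup>2\<close>.\<close>

lemma prob_connected_pairs_le:
  assumes n: "4 \<le> n"
  shows "prob_connected n (sym_perms n \<times> sym_perms n) \<le> 1 - 1 / real n + 1 / real n ^ 2"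
proof -
  let ?D = "{(\<sigma>, \<tau>). \<sigma> permutes {1..n} \<and> \<tau> permutes {1..n} \<and> intransitive {1..n} \<sigma> \<tau>}"
  have sq: "real n ^ 2 \<le> fact n"
    using square_le_fact[OF n] by (metis of_nat_fact of_nat_le_iff of_nat_power)
  have "n * 1 \<le> n ^ 2" unfolding power2_eq_square using n by (intro mult_le_mono2) simp
  then have le: "n \<le> fact n" using square_le_fact[OF n] by linarith
  have f: "(fact n :: real) = real n * fact (n - 1)" using n by (intro fact_reduce) simp
  have "1 / real n - 1 / real n ^ 2 \<le> 1 / real n - 1 / fact n"
    using sq n by (intro diff_left_mono divide_left_mono) auto
  also have "\<dots> = (fact n - real n) * fact (n - 1) / (fact n)\<^sup>2"
  proof -
    have "fact n * fact (n - 1) / (fact n)\<^sup>2 = 1 / real n"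
      unfolding f power2_eq_square using n by simp
    moreover have "real n * fact (n - 1) / (fact n)\<^sup>2 = 1 / fact n"
      unfolding f[symmetric] power2_eq_square by simp
    ultimately show ?thesis by (simp add: left_diff_distrib diff_divide_distrib)
  qed
  also have "\<dots> = real ((fact n - n) * fact (n - 1)) / (fact n)\<^sup>2" using le by (simp add: of_nat_diff)
  also have "\<dots> \<le> real (card ?D) / (fact n)\<^sup>2"
    using card_intransitive_pairs_ge[of "{1..n}"] n by (intro divide_right_mono of_nat_mono) auto
  finally have "1 / real n - 1 / real n ^ 2 \<le> real (card ?D) / (fact n)\<^sup>2" .
  moreover note prob_connected_pairs_eq[of n]
  ultimately show ?thesis by simp
qed

text \<open>Distinct fixed points have distinct orbits, so a permutation of cycle type \<open>\<mu>\<close> has at most \<open>size \<mu>\<close>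
  fixed points; the bound for a single permutation then holds uniformly over the class.\<close>

lemma prob_connected_conj_class_ge:
  assumes n: "0 < n" and \<mu>: "is_partition n \<mu>"
  shows "prob_connected n (conj_class n \<mu> \<times> sym_perms n) \<ge>
    1 - real (size \<mu>) / real n - block_union_bound n (size \<mu>)"
proof -
  let ?k = "size \<mu>" and ?K = "conj_class n \<mu>"
  let ?p = "real ?k / real n + block_union_bound n ?k"
  let ?D = "{(\<sigma>, \<tau>). \<sigma> \<in> ?K \<and> \<tau> permutes {1..n} \<and> intransitive {1..n} \<sigma> \<tau>}"
  let ?T = "\<lambda>\<sigma>. {\<tau>. \<tau> permutes {1..n} \<and> intransitive {1..n} \<sigma> \<tau>}"
  have sub: "?K \<subseteq> sym_perms n" by (auto simp: conj_class_def)
  have finP: "finite {\<sigma>. \<sigma> permutes {1..n}}" by (rule finite_permutations) simp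
  have finK: "finite ?K" using sub finP by (auto simp: sym_perms_def intro: finite_subset)
  have T: "real (card (?T \<sigma>)) \<le> ?p * fact n" if "\<sigma> \<in> ?K" for \<sigma>
  proof -
    have \<sigma>: "\<sigma> permutes {1..n}" using that by (auto simp: conj_class_def sym_perms_def)
    have orbs: "card (orbit \<sigma> ` {1..n}) = ?k"
      using that by (auto simp: conj_class_def cycle_type_def)
    have "inj_on (orbit \<sigma>) {x \<in> {1..n}. \<sigma> x = x}"
    proof (rule inj_onI)
      fix x y assume xy: "x \<in> {x \<in> {1..n}. \<sigma> x = x}" "y \<in> {x \<in> {1..n}. \<sigma> x = x}" and eq: "orbit \<sigma> x = orbit \<sigma> y"
      from xy have "orbit \<sigma> x = {x}" "orbit \<sigma> y = {y}"
        by (simp_all only: orbit_eq_singleton_iff mem_Collect_eq)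
      then show "x = y" using eq by (metis singleton_inject)
    qed
    then have fixed_le: "card {x \<in> {1..n}. \<sigma> x = x} \<le> ?k"
      unfolding orbs[symmetric] by (rule card_inj_on_le) auto
    have nf: "(fact n :: real) = real n * fact (n - 1)" using n by (rule fact_reduce)
    have "card (?T \<sigma>) \<le> card {x \<in> {1..n}. \<sigma> x = x} * fact (n - 1) +
        (\<Sum>r = 1..<n div 2. ((?k + r) choose r) * (fact (Suc r) * fact (n - Suc r)))"
      using card_intransitive_partners_le[OF \<sigma>] n orbs by simp
    also have "\<dots> \<le> ?k * fact (n - 1) +
        (\<Sum>r = 1..<n div 2. ((?k + r) choose r) * (fact (Suc r) * fact (n - Suc r)))"
      using fixed_le by simp
    finally have "real (card (?T \<sigma>)) \<le> real (?k * fact (n - 1) +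
        (\<Sum>r = 1..<n div 2. ((?k + r) choose r) * (fact (Suc r) * fact (n - Suc r))))"
      by (rule of_nat_mono)
    also have "\<dots> = real ?k * fact (n - 1) +
        (\<Sum>r = 1..<n div 2. real ((?k + r) choose r) * (fact (Suc r) * fact (n - Suc r)))"
      by (simp only: of_nat_add of_nat_mult of_nat_sum of_nat_fact)
    also have "(\<Sum>r = 1..<n div 2. real ((?k + r) choose r) * (fact (Suc r) * fact (n - Suc r))) =
        block_union_bound n ?k * fact n"
      unfolding block_union_bound_def sum_distrib_right
    proof (rule sum.cong[OF refl])
      fix r assume "r \<in> {1..<n div 2}"
      then have le: "Suc r \<le> n" by auto
      have "(fact n :: real) = fact (Suc r) * fact (n - Suc r) * real (n choose Suc r)"
        using binomial_fact_lemma[OF le] by (metis of_nat_fact of_nat_mult)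
      moreover have "real (n choose Suc r) > 0" using le by (simp del: binomial_Suc_Suc)
      ultimately show "real ((?k + r) choose r) * (fact (Suc r) * fact (n - Suc r)) =
          real ((?k + r) choose r) / real (n choose Suc r) * fact n"
        by simp
    qed
    also have "real ?k * fact (n - 1) = real ?k / real n * fact n" unfolding nf using n by simp
    finally show ?thesis by (simp only: distrib_right)
  qed
  have "?D = Sigma ?K ?T" by auto
  then have "real (card ?D) = (\<Sum>\<sigma>\<in>?K. real (card (?T \<sigma>)))"
    using finK finP by (simp add: card_SigmaI)
  also have "\<dots> \<le> (\<Sum>\<sigma>\<in>?K. ?p * fact n)" using T by (rule sum_mono)
  also have "\<dots> = ?p * (real (card ?K) * fact n)" by simp
  finally have "real (card ?D) / (real (card ?K) * fact n) \<le> ?p"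
    using finK conj_class_nonempty[OF \<mu>] by (subst pos_divide_le_eq) (auto simp: card_gt_0_iff)
  then show ?thesis
    unfolding prob_connected_eq[OF sub conj_class_nonempty[OF \<mu>]] by linarith
qed

theorem proposition6p2:
  shows "((\<lambda>n::nat. prob_connected n (sym_perms n \<times> sym_perms n) - (1 - 1 / real n))
            \<in> O(\<lambda>n. 1 / (real n)\<^sup>2)) \<and>
         (\<forall>\<alpha>::real. 0 \<le> \<alpha> \<and> \<alpha> < 1 \<longrightarrow>
            (\<exists>E::nat \<Rightarrow> real. E \<in> O(\<lambda>n. 1 / real n powr (2 - \<alpha>)) \<and>
               (\<forall>\<^sub>F n in sequentially. \<forall>\<mu>::nat multiset.
                  is_partition n \<mu> \<and> real (size \<mu>) \<le> real n powr \<alpha> \<longrightarrow>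
                  prob_connected n (conj_class n \<mu> \<times> sym_perms n)
                    > 1 - 1 / real n powr (1 - \<alpha>) - E n)))"
proof -
  obtain C :: real where C: "C \<ge> 0"
    "\<And>n k. 1 \<le> k \<Longrightarrow> 4 * k \<le> n \<Longrightarrow> block_union_bound n k \<le> C * real k / real n ^ 2"
    using block_union_bound_le by blast
  show ?thesis
  proof (intro conjI allI impI)
    show "(\<lambda>n::nat. prob_connected n (sym_perms n \<times> sym_perms n) - (1 - 1 / real n))
        \<in> O(\<lambda>n. 1 / (real n)\<^sup>2)"
    proof (rule bigoI)
      show "\<forall>\<^sub>F n in sequentially. norm (prob_connected n (sym_perms n \<times> sym_perms n) - (1 - 1 / real n))
          \<le> (C + 1) * norm (1 / (real n)\<^sup>2)"
      proof (rule eventually_sequentiallyI)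
        fix n :: nat assume n: "4 \<le> n"
        have "block_union_bound n 1 \<le> C * real 1 / real n ^ 2" by (rule C(2)) (use n in auto)
        then have "block_union_bound n 1 \<le> C / real n ^ 2" by simp
        moreover have "0 \<le> C / real n ^ 2" "0 \<le> 1 / real n ^ 2" using C(1) by simp_all
        ultimately have "\<bar>prob_connected n (sym_perms n \<times> sym_perms n) - (1 - 1 / real n)\<bar>
            \<le> C / real n ^ 2 + 1 / real n ^ 2"
          using prob_connected_pairs_ge[of n] prob_connected_pairs_le[OF n] n by linarith
        then show "norm (prob_connected n (sym_perms n \<times> sym_perms n) - (1 - 1 / real n))
            \<le> (C + 1) * norm (1 / (real n)\<^sup>2)"
          by (simp add: add_divide_distrib)
      qed
    qed
  next
    fix \<alpha> :: real assume \<alpha>: "0 \<le> \<alpha> \<and> \<alpha> < 1"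
    \<comment> \<open>The summand \<open>1\<close> in \<open>C + 1\<close> makes the inequality strict.\<close>
    define E where "E n = (C + 1) / real n powr (2 - \<alpha>)" for n :: nat
    have "E \<in> O(\<lambda>n. 1 / real n powr (2 - \<alpha>))"
      by (rule bigoI[of _ "C + 1"]) (use C(1) in \<open>simp add: E_def\<close>)
    moreover have "(\<lambda>n::nat. real n powr (\<alpha> - 1)) \<longlonglongrightarrow> 0"
      using \<alpha> by (intro tendsto_neg_powr filterlim_real_sequentially) auto
    \<comment> \<open>Here \<open>\<alpha> < 1\<close> enters: the number of cycles is eventually below \<open>n / 4\<close>.\<close>
    then have "\<forall>\<^sub>F n::nat in sequentially. real n powr (\<alpha> - 1) < 1 / 4"
      by (rule order_tendstoD) simp
    then have "\<forall>\<^sub>F n in sequentially. \<forall>\<mu>::nat multiset.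
        is_partition n \<mu> \<and> real (size \<mu>) \<le> real n powr \<alpha> \<longrightarrow>
        prob_connected n (conj_class n \<mu> \<times> sym_perms n) > 1 - 1 / real n powr (1 - \<alpha>) - E n"
      using eventually_gt_at_top[of 0]
    proof eventually_elim
      case (elim n)
      have n: "real n > 0" using elim(2) by simp
      show ?case
      proof (intro allI impI)
        fix \<mu> :: "nat multiset"
        assume \<mu>: "is_partition n \<mu> \<and> real (size \<mu>) \<le> real n powr \<alpha>"
        have p1: "real n powr \<alpha> / real n = real n powr (\<alpha> - 1)"
          using n by (simp add: powr_diff)
        have p2: "real n powr \<alpha> / real n ^ 2 = 1 / real n powr (2 - \<alpha>)"
          using n by (simp add: powr_diff powr_numeral)
        have p3: "real n powr (\<alpha> - 1) = 1 / real n powr (1 - \<alpha>)"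
          by (simp add: powr_minus_divide[symmetric])
        have k1: "real (size \<mu>) / real n \<le> 1 / real n powr (1 - \<alpha>)"
          unfolding p3[symmetric] p1[symmetric] using \<mu> by (intro divide_right_mono) auto
        have k2: "C * real (size \<mu>) / real n ^ 2 \<le> C * (1 / real n powr (2 - \<alpha>))"
          unfolding p2[symmetric] times_divide_eq_right
          using \<mu> C(1) by (intro divide_right_mono mult_left_mono) auto
        have "real (size \<mu>) / real n < 1 / 4" using k1 p3 elim(1) by linarith
        then have "real (4 * size \<mu>) \<le> real n" using n by (simp add: field_simps)
        then have "4 * size \<mu> \<le> n" by (simp only: of_nat_le_iff)
        moreover have "1 \<le> size \<mu>"
          using \<mu> elim(2) by (cases "\<mu> = {#}") (auto simp: is_partition_def Suc_le_eq nonempty_has_size)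
        ultimately have "block_union_bound n (size \<mu>) \<le> C * real (size \<mu>) / real n ^ 2"
          by (intro C(2))
        moreover have "prob_connected n (conj_class n \<mu> \<times> sym_perms n) \<ge>
            1 - real (size \<mu>) / real n - block_union_bound n (size \<mu>)"
          using \<mu> elim(2) by (intro prob_connected_conj_class_ge) auto
        moreover have "E n = C * (1 / real n powr (2 - \<alpha>)) + 1 / real n powr (2 - \<alpha>)"
          by (simp add: E_def add_divide_distrib)
        moreover have "1 / real n powr (2 - \<alpha>) > 0" using n by simp
        ultimately show "prob_connected n (conj_class n \<mu> \<times> sym_perms n) > 1 - 1 / real n powr (1 - \<alpha>) - E n"
          using k1 k2 by linarith
      qed
    qed
    ultimately show "\<exists>E::nat \<Rightarrow> real. E \<in> O(\<lambda>n. 1 / real n powr (2 - \<alpha>)) \<and>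
        (\<forall>\<^sub>F n in sequentially. \<forall>\<mu>::nat multiset.
           is_partition n \<mu> \<and> real (size \<mu>) \<le> real n powr \<alpha> \<longrightarrow>
           prob_connected n (conj_class n \<mu> \<times> sym_perms n) > 1 - 1 / real n powr (1 - \<alpha>) - E n)"
      by blast
  qed
qed

end
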